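(* Let $G$ be a vertex decomposable graph such that $\mathrm{Shed}(G)$ is not a dominating set of $G$. Let $x\in\mathrm{Shed}(G)$, and let $H$ be the graph with vertex set $V(G)\cup\{x'\}$ ($x'$ a new vertex) and edge set $E(G)\cup\{\{x',y\}: y\in N[x]\}$. Then $H$ is vertex decomposable and $\mathrm{Shed}(H)$ is not a dominating set of $H$.
   Context: All graphs are finite and simple. For a graph $G=(V,E)$ and $x\in V$, $G\setminus x$ is the graph obtained by deleting $x$ and its incident edges; $N(x)$ is the set of neighbours of $x$, $N[x]=N(x)\cup\{x\}$, and $G\setminus N[x]$ is obtained by deleting all vertices of $N[x]$ and their incident edges. A graph is well-covered if all its maximal independent sets have the same cardinality. A graph $G$ is vertex decomposable if $G$ is well-covered and either (i) $G$ has no edges (possibly no vertices), or (ii) there is a vertex $x$ such that both $G\setminus x$ and $G\setminus N[x]$ are vertex decomposable. For a vertex decomposable graph $G$, $\mathrm{Shed}(G)$ is the set of vertices $x$ such that $G\setminus x$ and $G\setminus N[x]$ are both vertex decomposable. A set $D\subseteq V$ is dominating if every vertex of $V\setminus D$ is adjacent to a vertex of $D$. *)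

theory Defs
  imports Main
begin

(* A pair (vertex set, edge set); edges are two-element sets of vertices. *)
type_synonym 'a sgraph = "'a set \<times> 'a set set"

abbreviation verts :: "'a sgraph \<Rightarrow> 'a set" where
  "verts G \<equiv> fst G"

abbreviation edges :: "'a sgraph \<Rightarrow> 'a set set" where
  "edges G \<equiv> snd G"

definition finite_simple_graph :: "'a sgraph \<Rightarrow> bool" where
  "finite_simple_graph G \<longleftrightarrow> finite (verts G) \<and> (\<forall>e\<in>edges G. e \<subseteq> verts G \<and> card e = 2)"

definition nbhd :: "'a sgraph \<Rightarrow> 'a \<Rightarrow> 'a set" where
  "nbhd G x = {y. {x, y} \<in> edges G}"

definition closed_nbhd :: "'a sgraph \<Rightarrow> 'a \<Rightarrow> 'a set" where
  "closed_nbhd G x = insert x (nbhd G x)"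

definition del_verts :: "'a sgraph \<Rightarrow> 'a set \<Rightarrow> 'a sgraph" where
  "del_verts G S = (verts G - S, {e \<in> edges G. e \<inter> S = {}})"

definition independent_set :: "'a sgraph \<Rightarrow> 'a set \<Rightarrow> bool" where
  "independent_set G S \<longleftrightarrow> S \<subseteq> verts G \<and> (\<forall>u\<in>S. \<forall>v\<in>S. {u, v} \<notin> edges G)"

definition maximal_independent_set :: "'a sgraph \<Rightarrow> 'a set \<Rightarrow> bool" where
  "maximal_independent_set G S \<longleftrightarrow>
     independent_set G S \<and> (\<forall>T. independent_set G T \<and> S \<subseteq> T \<longrightarrow> T = S)"

definition well_covered :: "'a sgraph \<Rightarrow> bool" where
  "well_covered G \<longleftrightarrow>
     (\<forall>S T. maximal_independent_set G S \<and> maximal_independent_set G T \<longrightarrow> card S = card T)"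

(* The recursion of the definition deletes at least one vertex at each step, so for finite
   graphs the least fixed point is the only predicate satisfying the recursive description. *)
inductive vertex_decomposable :: "'a sgraph \<Rightarrow> bool" where
  edgeless: "well_covered G \<Longrightarrow> edges G = {} \<Longrightarrow> vertex_decomposable G"
| shed: "well_covered G \<Longrightarrow> x \<in> verts G \<Longrightarrow> vertex_decomposable (del_verts G {x}) \<Longrightarrow>
    vertex_decomposable (del_verts G (closed_nbhd G x)) \<Longrightarrow> vertex_decomposable G"

definition Shed :: "'a sgraph \<Rightarrow> 'a set" where
  "Shed G = {x \<in> verts G. vertex_decomposable (del_verts G {x}) \<and>
     vertex_decomposable (del_verts G (closed_nbhd G x))}"

definition dominating_set :: "'a sgraph \<Rightarrow> 'a set \<Rightarrow> bool" where
  "dominating_set G D \<longleftrightarrow> D \<subseteq> verts G \<and> (\<forall>v \<in> verts G - D. \<exists>u\<in>D. {u, v} \<in> edges G)"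

lemma finite_simple_graph_del_verts:
  "finite_simple_graph G \<Longrightarrow> finite_simple_graph (del_verts G S)"
  by (auto simp: finite_simple_graph_def del_verts_def)

lemma finite_simple_graph_add_closed_twin:
  assumes "finite_simple_graph G" "x \<in> verts G" "x' \<notin> verts G"
  shows "finite_simple_graph
    (insert x' (verts G), edges G \<union> {{x', y} | y. y \<in> closed_nbhd G x})"
proof -
  have "closed_nbhd G x \<subseteq> verts G"
    using assms(1,2) by (auto simp: finite_simple_graph_def closed_nbhd_def nbhd_def)
  then show ?thesis
    using assms by (auto simp: finite_simple_graph_def card_2_iff; blast)
qed

end

theory Submission imports Defs "HOL-Combinatorics.Transposition" begin

text \<open>
  The new vertex \<open>x'\<close> is a closed twin of \<open>x\<close>: they have the same closed neighbourhood.
  Deleting one of two closed twins preserves and reflects well-coveredness, and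
  \<open>H \ x' = G\<close>, \<open>H \ N[x'] = G \ N[x]\<close>, so \<open>x'\<close> is a shedding vertex of \<open>H\<close>.
  Deleting one of two closed twins also preserves vertex decomposability: a shedding vertex
  other than the twins can still be shed, and the two twins are exchanged by an automorphism.
  Hence every shedding vertex of \<open>H\<close> other than \<open>x'\<close> is one of \<open>G\<close>. A vertex of \<open>G\<close>
  which is not dominated by \<open>Shed G\<close> is not adjacent to \<open>x\<close>, therefore not to \<open>x'\<close> either,
  and so it is not dominated by \<open>Shed H\<close>.
\<close>

definition map_graph :: "('a \<Rightarrow> 'b) \<Rightarrow> 'a sgraph \<Rightarrow> 'b sgraph" where
  "map_graph f G = (f ` verts G, (`) f ` edges G)"

text \<open>Adjacency is built in: \<open>y\<close> lies in its own closed neighbourhood, hence in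
  that of \<open>x\<close>. In a finite simple graph both are then vertices.\<close>

definition closed_twins :: "'a sgraph \<Rightarrow> 'a \<Rightarrow> 'a \<Rightarrow> bool" where
  "closed_twins G x y \<longleftrightarrow> x \<noteq> y \<and> closed_nbhd G x = closed_nbhd G y"

lemma finite_simple_graph_no_loop:
  "finite_simple_graph G \<Longrightarrow> {x} \<notin> edges G"
  by (auto simp: finite_simple_graph_def)

lemma finite_simple_graph_edge_verts:
  "finite_simple_graph G \<Longrightarrow> {x, y} \<in> edges G \<Longrightarrow> x \<in> verts G \<and> y \<in> verts G"
  by (auto simp: finite_simple_graph_def)

lemma del_verts_del_verts: "del_verts (del_verts G S) T = del_verts G (S \<union> T)"
  by (auto simp: del_verts_def)

lemma closed_nbhd_del_verts:
  "x \<notin> S \<Longrightarrow> closed_nbhd (del_verts G S) x = closed_nbhd G x - S"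
  by (auto simp: closed_nbhd_def nbhd_def del_verts_def)

lemma mem_closed_nbhd_commute: "y \<in> closed_nbhd G x \<longleftrightarrow> x \<in> closed_nbhd G y"
  by (auto simp: closed_nbhd_def nbhd_def insert_commute)

section \<open>Transport of graphs along injections and bijections\<close>

lemma verts_map_graph [simp]: "verts (map_graph f G) = f ` verts G"
  and edges_map_graph: "edges (map_graph f G) = (`) f ` edges G"
  by (simp_all add: map_graph_def)

lemma image_mem_edges_map_graph:
  "inj f \<Longrightarrow> f ` e \<in> edges (map_graph f G) \<longleftrightarrow> e \<in> edges G"
  by (simp add: edges_map_graph inj_image_mem_iff inj_image_eq_iff inj_on_def)

lemma pair_mem_edges_map_graph:
  "inj f \<Longrightarrow> {f x, f y} \<in> edges (map_graph f G) \<longleftrightarrow> {x, y} \<in> edges G"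
  using image_mem_edges_map_graph[of f "{x, y}" G] by simp

lemma del_verts_map_graph:
  assumes "inj f"
  shows "del_verts (map_graph f G) (f ` S) = map_graph f (del_verts G S)"
proof -
  have "f ` e \<inter> f ` S = {} \<longleftrightarrow> e \<inter> S = {}" for e
    using assms by (auto dest: injD)
  then show ?thesis
    using assms by (auto simp: del_verts_def map_graph_def image_set_diff)
qed

lemma closed_nbhd_map_graph:
  assumes "bij f"
  shows "closed_nbhd (map_graph f G) (f x) = f ` closed_nbhd G x"
proof -
  have "u \<in> closed_nbhd (map_graph f G) (f x) \<longleftrightarrow> u \<in> f ` closed_nbhd G x" for u
  proof -
    obtain v where "u = f v"
      using assms by (metis bij_pointE)
    then show ?thesis
      using assms
      by (simp add: closed_nbhd_def nbhd_def bij_is_inj inj_image_mem_iff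
          pair_mem_edges_map_graph inj_eq)
  qed
  then show ?thesis by blast
qed

lemma independent_set_map_graph:
  "inj f \<Longrightarrow> independent_set (map_graph f G) (f ` S) \<longleftrightarrow> independent_set G S"
  by (simp add: independent_set_def pair_mem_edges_map_graph inj_image_subset_iff)

lemma maximal_independent_set_map_graph:
  assumes "bij f"
  shows "maximal_independent_set (map_graph f G) (f ` S) \<longleftrightarrow> maximal_independent_set G S"
proof -
  have surj: "\<exists>T. U = f ` T" for U
    using assms by (metis bij_is_surj surj_image_vimage_eq)
  \<comment> \<open>As \<open>f\<close> is onto, the competitors in the maximality condition may all
    be taken to be images, and both conditions then agree term by term.\<close>
  have "(\<forall>U. P U) \<longleftrightarrow> (\<forall>T. P (f ` T))" for P
    using surj by metis
  then show ?thesis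
    using assms
    by (simp add: maximal_independent_set_def bij_is_inj independent_set_map_graph
        inj_image_subset_iff inj_image_eq_iff)
qed

lemma well_covered_map_graph:
  assumes "bij f" "well_covered G"
  shows "well_covered (map_graph f G)"
  unfolding well_covered_def
proof (intro allI impI)
  fix S T
  assume *: "maximal_independent_set (map_graph f G) S \<and> maximal_independent_set (map_graph f G) T"
  obtain S' T' where "S = f ` S'" "T = f ` T'"
    using assms(1) by (metis bij_is_surj surj_image_vimage_eq)
  with * assms show "card S = card T"
    by (simp add: maximal_independent_set_map_graph well_covered_def card_image
        inj_on_subset[OF bij_is_inj])
qed

text \<open>Serves to pass from the deletion of one twin to that of the other, with \<open>f\<close>
  the transposition of the two.\<close>

lemma vertex_decomposable_map_graph:
  assumes "vertex_decomposable G" "bij f"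
  shows "vertex_decomposable (map_graph f G)"
  using assms(1)
proof induction
  case (edgeless G)
  then show ?case
    using assms(2)
    by (auto intro: vertex_decomposable.edgeless well_covered_map_graph simp: edges_map_graph)
next
  case (shed G x)
  show ?case
  proof (rule vertex_decomposable.shed[of _ "f x"])
    show "vertex_decomposable (del_verts (map_graph f G) {f x})"
      using shed.IH(1) del_verts_map_graph[of f G "{x}"] assms(2) by (simp add: bij_is_inj)
    show "vertex_decomposable (del_verts (map_graph f G) (closed_nbhd (map_graph f G) (f x)))"
      using shed.IH(2) assms(2)
      by (simp add: closed_nbhd_map_graph del_verts_map_graph bij_is_inj)
  qed (use shed assms(2) in \<open>auto intro: well_covered_map_graph\<close>)
qed

section \<open>Closed twins and the automorphism exchanging them\<close>

lemma closed_twins_edge: "closed_twins G x y \<Longrightarrow> {x, y} \<in> edges G"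
  by (auto simp: closed_twins_def closed_nbhd_def nbhd_def)

lemma closed_twins_edge_iff:
  "closed_twins G x y \<Longrightarrow> z \<noteq> x \<Longrightarrow> z \<noteq> y \<Longrightarrow> {x, z} \<in> edges G \<longleftrightarrow> {y, z} \<in> edges G"
  by (auto simp: closed_twins_def closed_nbhd_def nbhd_def)

lemma closed_twins_del_verts:
  "closed_twins G x y \<Longrightarrow> x \<notin> S \<Longrightarrow> y \<notin> S \<Longrightarrow> closed_twins (del_verts G S) x y"
  by (simp add: closed_twins_def closed_nbhd_del_verts)

lemma closed_twins_mem_closed_nbhd_iff:
  "closed_twins G x y \<Longrightarrow> x \<in> closed_nbhd G z \<longleftrightarrow> y \<in> closed_nbhd G z"
  by (metis closed_twins_def mem_closed_nbhd_commute)

text \<open>An edge containing both twins or neither is fixed; one containing a single twin goes to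
  the edge joining its other end to the other twin.\<close>

lemma map_graph_transpose_closed_twins:
  assumes G: "finite_simple_graph G" and tw: "closed_twins G x y"
  shows "map_graph (transpose x y) G = G"
proof -
  have V: "x \<in> verts G" "y \<in> verts G"
    using finite_simple_graph_edge_verts[OF G closed_twins_edge[OF tw]] by auto
  have xy: "x \<noteq> y" using tw by (simp add: closed_twins_def)
  have E: "transpose x y ` e \<in> edges G" if e: "e \<in> edges G" for e
  proof -
    obtain u v where uv: "e = {u, v}" "u \<noteq> v"
      using G e by (auto simp: finite_simple_graph_def card_2_iff)
    show ?thesis
      using e uv xy closed_twins_edge_iff[OF tw, of u] closed_twins_edge_iff[OF tw, of v]
      by (cases "u = x"; cases "u = y"; cases "v = x"; cases "v = y")
        (auto simp: insert_commute)
  qed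
  have "(`) (transpose x y) ` edges G = edges G"
  proof
    show "(`) (transpose x y) ` edges G \<subseteq> edges G"
      using E by auto
    \<comment> \<open>The transposition is an involution, so \<open>E\<close> for the image of
      \<open>e\<close> yields the reverse inclusion.\<close>
    show "edges G \<subseteq> (`) (transpose x y) ` edges G"
    proof
      fix e assume "e \<in> edges G"
      moreover have "e = transpose x y ` (transpose x y ` e)"
        by (simp add: image_comp)
      ultimately show "e \<in> (`) (transpose x y) ` edges G"
        using E by blast
    qed
  qed
  moreover have "transpose x y ` verts G = verts G"
    using V by simp
  ultimately show ?thesis
    by (simp add: map_graph_def)
qed

section \<open>Deletion of a closed twin\<close>

lemma maximal_independent_set_del_closed_twin:
  assumes G: "finite_simple_graph G" and tw: "closed_twins G x y" and y: "y \<notin> S"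
  shows "maximal_independent_set (del_verts G {y}) S \<longleftrightarrow> maximal_independent_set G S"
proof -
  have ind: "independent_set (del_verts G {y}) T \<longleftrightarrow> independent_set G T \<and> y \<notin> T" for T
    by (auto simp: independent_set_def del_verts_def)
  have V: "x \<in> verts G" "y \<in> verts G"
    using finite_simple_graph_edge_verts[OF G closed_twins_edge[OF tw]] by auto
  show ?thesis
  proof
    assume S: "maximal_independent_set (del_verts G {y}) S"
    show "maximal_independent_set G S"
      unfolding maximal_independent_set_def
    proof (intro conjI allI impI)
      show "independent_set G S"
        using S by (simp add: maximal_independent_set_def ind)
      fix T assume T: "independent_set G T \<and> S \<subseteq> T"
      \<comment> \<open>If \<open>y\<close> were in \<open>T\<close>, no element of \<open>S\<close>
        would be adjacent to \<open>y\<close>, hence none to \<open>x\<close>; then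
        \<open>insert x S\<close> would be independent and avoid \<open>y\<close>, against
        maximality of \<open>S\<close> in the smaller graph.\<close>
      have "y \<notin> T"
      proof
        assume yT: "y \<in> T"
        then have xS: "x \<notin> S"
          using T closed_twins_edge[OF tw] by (auto simp: independent_set_def)
        have "{x, u} \<notin> edges G" if "u \<in> S" for u
        proof -
          have "u \<noteq> x" "u \<noteq> y" "{y, u} \<notin> edges G"
            using that xS y yT T by (auto simp: independent_set_def)
          then show ?thesis
            using closed_twins_edge_iff[OF tw] by blast
        qed
        then have "independent_set G (insert x S)"
          using T V finite_simple_graph_no_loop[OF G]
          by (simp add: independent_set_def insert_commute) blast
        then have "independent_set (del_verts G {y}) (insert x S)"
          using y tw by (auto simp: ind closed_twins_def)
        then show False
          using S xS by (auto simp: maximal_independent_set_def)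
      qed
      with S T show "T = S"
        by (simp add: maximal_independent_set_def ind)
    qed
  next
    assume "maximal_independent_set G S"
    then show "maximal_independent_set (del_verts G {y}) S"
      using y by (simp add: maximal_independent_set_def ind)
  qed
qed

text \<open>Maximal independent sets avoiding \<open>y\<close> are the same in both graphs. One
  containing \<open>y\<close> avoids \<open>x\<close>, and exchanging the twins gives one of equal
  size avoiding \<open>y\<close>.\<close>

lemma well_covered_del_closed_twin_iff:
  assumes G: "finite_simple_graph G" and tw: "closed_twins G x y"
  shows "well_covered (del_verts G {y}) \<longleftrightarrow> well_covered G"
proof
  assume wc: "well_covered (del_verts G {y})"
  have "\<exists>S'. maximal_independent_set (del_verts G {y}) S' \<and> card S' = card S"
    if S: "maximal_independent_set G S" for S
  proof (cases "y \<in> S")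
    case True
    let ?S' = "transpose x y ` S"
    have "x \<notin> S"
      using True S closed_twins_edge[OF tw]
      by (auto simp: maximal_independent_set_def independent_set_def)
    then have "y \<notin> ?S'"
      by (metis imageE transpose_eq_iff transpose_apply_second)
    moreover have "maximal_independent_set G ?S'"
      using maximal_independent_set_map_graph[of "transpose x y" G S] S
      by (simp add: map_graph_transpose_closed_twins[OF G tw])
    moreover have "card ?S' = card S"
      by (simp add: card_image)
    ultimately show ?thesis
      using maximal_independent_set_del_closed_twin[OF G tw] by blast
  next
    case False
    then show ?thesis
      using S maximal_independent_set_del_closed_twin[OF G tw] by blast
  qed
  then show "well_covered G"
    using wc unfolding well_covered_def by metis
next
  assume wc: "well_covered G"
  have "maximal_independent_set G S" if "maximal_independent_set (del_verts G {y}) S" for S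
  proof -
    have "y \<notin> S"
      using that by (auto simp: maximal_independent_set_def independent_set_def del_verts_def)
    then show ?thesis
      using that maximal_independent_set_del_closed_twin[OF G tw] by blast
  qed
  then show "well_covered (del_verts G {y})"
    using wc unfolding well_covered_def by blast
qed

text \<open>Either \<open>y\<close> disappears with the closed neighbourhood of \<open>z\<close>
  anyway, or it survives and the two deletions commute.\<close>

lemma del_closed_nbhd_del_vertex:
  assumes "z \<noteq> y"
  shows "del_verts (del_verts G {y}) (closed_nbhd (del_verts G {y}) z) =
    (if y \<in> closed_nbhd G z then del_verts G (closed_nbhd G z)
     else del_verts (del_verts G (closed_nbhd G z)) {y})"
  using assms by (auto simp: closed_nbhd_del_verts del_verts_del_verts insert_absorb)

lemma vertex_decomposable_del_closed_twin:
  assumes "vertex_decomposable G" "finite_simple_graph G" "closed_twins G x y"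
  shows "vertex_decomposable (del_verts G {y})"
  using assms
proof induction
  case (edgeless G)
  \<comment> \<open>Twins are adjacent, so an edgeless graph has none.\<close>
  then show ?case
    using closed_twins_edge[of G x y] by simp
next
  case (shed G z)
  note G = \<open>finite_simple_graph G\<close> and tw = \<open>closed_twins G x y\<close>
  consider "z = y" | "z = x" | "z \<noteq> x" "z \<noteq> y" by blast
  then show ?case
  proof cases
    case 1
    then show ?thesis using shed.hyps by simp
  next
    case 2
    \<comment> \<open>The exchange of the twins fixes \<open>G\<close> and carries \<open>x\<close>
      to \<open>y\<close>.\<close>
    have "del_verts G {y} = map_graph (transpose x y) (del_verts G {x})"
      using del_verts_map_graph[of "transpose x y" G "{x}"]
      by (simp add: map_graph_transpose_closed_twins[OF G tw])
    then show ?thesis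
      using shed.hyps(3) 2 by (simp add: vertex_decomposable_map_graph)
  next
    case 3
    show ?thesis
    proof (rule vertex_decomposable.shed)
      show "well_covered (del_verts G {y})"
        using well_covered_del_closed_twin_iff[OF G tw] shed.hyps(1) by blast
      show "z \<in> verts (del_verts G {y})"
        using shed.hyps(2) 3 by (simp add: del_verts_def)
      have "vertex_decomposable (del_verts (del_verts G {z}) {y})"
        using 3 by (intro shed.IH finite_simple_graph_del_verts G closed_twins_del_verts tw) auto
      then show "vertex_decomposable (del_verts (del_verts G {y}) {z})"
        by (simp add: del_verts_del_verts insert_commute)
      \<comment> \<open>The closed neighbourhood of \<open>z\<close> contains both twins or neither,
        so if \<open>y\<close> survives then so does \<open>x\<close>, and they remain
        twins.\<close>
      have "vertex_decomposable (del_verts (del_verts G (closed_nbhd G z)) {y})"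
        if "y \<notin> closed_nbhd G z"
        using that closed_twins_mem_closed_nbhd_iff[OF tw]
        by (intro shed.IH finite_simple_graph_del_verts G closed_twins_del_verts tw) auto
      then show "vertex_decomposable
          (del_verts (del_verts G {y}) (closed_nbhd (del_verts G {y}) z))"
        using shed.hyps(4) 3 by (simp add: del_closed_nbhd_del_vertex)
    qed
  qed
qed

text \<open>The argument for a shedding vertex other than the twins, with the preceding lemma in
  place of the induction hypothesis. The twins are excluded: \<open>y\<close> is no longer a vertex,
  and shedding \<open>x\<close> would require the graph without both twins to be vertex
  decomposable.\<close>

lemma Shed_subset_Shed_del_closed_twin:
  assumes G: "finite_simple_graph G" and tw: "closed_twins G x y"
  shows "Shed G - {x, y} \<subseteq> Shed (del_verts G {y})"
proof
  fix z assume z: "z \<in> Shed G - {x, y}"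
  have "vertex_decomposable (del_verts (del_verts G {z}) {y})"
    using z by (intro vertex_decomposable_del_closed_twin[
          OF _ finite_simple_graph_del_verts[OF G] closed_twins_del_verts[OF tw]])
      (auto simp: Shed_def)
  then have 1: "vertex_decomposable (del_verts (del_verts G {y}) {z})"
    by (simp add: del_verts_del_verts insert_commute)
  have "vertex_decomposable (del_verts (del_verts G (closed_nbhd G z)) {y})"
    if "y \<notin> closed_nbhd G z"
    using z that closed_twins_mem_closed_nbhd_iff[OF tw]
    by (intro vertex_decomposable_del_closed_twin[
          OF _ finite_simple_graph_del_verts[OF G] closed_twins_del_verts[OF tw]])
      (auto simp: Shed_def)
  then have "vertex_decomposable
      (del_verts (del_verts G {y}) (closed_nbhd (del_verts G {y}) z))"
    using z by (simp add: del_closed_nbhd_del_vertex Shed_def)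
  with 1 z show "z \<in> Shed (del_verts G {y})"
    by (auto simp: Shed_def del_verts_def)
qed

theorem theorem7p1:
  fixes G H :: "'a sgraph" and x x' :: 'a
  assumes "finite_simple_graph G"
    and "vertex_decomposable G"
    and "\<not> dominating_set G (Shed G)"
    and "x \<in> Shed G"
    and "x' \<notin> verts G"
    and "H = (insert x' (verts G), edges G \<union> {{x', y} | y. y \<in> closed_nbhd G x})"
  shows "vertex_decomposable H \<and> \<not> dominating_set H (Shed H)"
proof -
  have xV: "x \<in> verts G" using assms(4) by (simp add: Shed_def)
  have H: "finite_simple_graph H"
    using finite_simple_graph_add_closed_twin[OF assms(1) xV assms(5)] assms(6) by simp
  have edge_notin: "x' \<notin> e" if "e \<in> edges G" for e
    using assms(1,5) that by (auto simp: finite_simple_graph_def)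
  have del: "del_verts H {x'} = G"
    using assms(5,6) edge_notin by (auto simp: del_verts_def prod_eq_iff)
  have Nx': "closed_nbhd H x' = insert x' (closed_nbhd G x)"
    using edge_notin assms(6)
    by (auto simp: closed_nbhd_def nbhd_def doubleton_eq_iff)
  have Nx: "closed_nbhd H x = insert x' (closed_nbhd G x)"
    using xV assms(5,6)
    by (auto simp: closed_nbhd_def nbhd_def doubleton_eq_iff)
  have tw: "closed_twins H x x'"
    using Nx Nx' xV assms(5) by (auto simp: closed_twins_def)
  \<comment> \<open>Remove \<open>x'\<close> first, which leaves \<open>G\<close>, and then the
    closed neighbourhood of \<open>x\<close> in \<open>G\<close>.\<close>
  have "del_verts H (closed_nbhd H x') = del_verts G (closed_nbhd G x)"
    using del_verts_del_verts[of H "{x'}" "closed_nbhd G x"] by (simp add: del Nx')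
  \<comment> \<open>Well-coveredness of \<open>H\<close> is reflected from \<open>G\<close>, the
    deletion of the twin \<open>x'\<close>.\<close>
  then have "vertex_decomposable H"
    using assms(2,4,6) del well_covered_del_closed_twin_iff[OF H tw]
    by (intro vertex_decomposable.shed[of H x'])
       (auto simp: Shed_def elim: vertex_decomposable.cases)
  moreover have "\<not> dominating_set H (Shed H)"
  proof -
    \<comment> \<open>The lemma leaves out the twin \<open>x\<close>, but \<open>x\<close> is in
      \<open>Shed G\<close> by assumption.\<close>
    have sub: "Shed H \<subseteq> insert x' (Shed G)"
      using Shed_subset_Shed_del_closed_twin[OF H tw] del assms(4) by auto
    \<comment> \<open>\<open>Shed G\<close> consists of vertices, so domination can fail only
      through an undominated vertex.\<close>
    obtain z where z: "z \<in> verts G" "z \<notin> Shed G" "\<And>u. u \<in> Shed G \<Longrightarrow> {u, z} \<notin> edges G"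
      using assms(3) by (auto simp: dominating_set_def Shed_def)
    have zx': "z \<noteq> x'" using z(1) assms(5) by auto
    \<comment> \<open>As \<open>x\<close> is in \<open>Shed G\<close>, the vertex \<open>z\<close>
      is neither equal nor adjacent to it; so \<open>x'\<close> does not dominate \<open>z\<close>
      either.\<close>
    have "z \<notin> closed_nbhd G x"
      using z assms(4) by (auto simp: closed_nbhd_def nbhd_def)
    then have "{x', z} \<notin> edges H"
      using edge_notin zx' assms(6) by (auto simp: doubleton_eq_iff)
    moreover have "{u, z} \<notin> edges H" if "u \<in> Shed G" for u
      using z(3)[OF that] that assms(5,6) zx' by (auto simp: Shed_def doubleton_eq_iff)
    ultimately have "\<forall>u\<in>Shed H. {u, z} \<notin> edges H"
      using sub by blast
    moreover have "z \<in> verts H - Shed H"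
      using z zx' sub assms(6) by auto
    ultimately show ?thesis
      by (auto simp: dominating_set_def)
  qed
  ultimately show ?thesis ..
qed

end
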